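(* Let $\eta_1,\eta_2,\eta_3>0$, $\sigma_1,\sigma_2\in\mathbb R$, and suppose that $$\gamma_j(-\mathbf n)<3\gamma_j(\mathbf n)\qquad\forall\,\mathbf n\in\mathbb S^1,\ j=1,2,3,$$ and that the stabilizing functions $K_j$ are taken sufficiently large (i.e. there are functions $K_j^{0}:\mathbb S^1\to[0,\infty)$, depending only on $\gamma_j$, such that the conclusion below holds whenever $K_j(\mathbf n)\ge K_j^{0}(\mathbf n)$ for all $\mathbf n\in\mathbb S^1$, $j=1,2,3$). Let $\mathbf X^0\in\mathbb V^h$ be given, and let $(\mathbf X^m,\mu^m)\in\mathbb V^h\times\mathbb W^h$ be a solution of the following scheme: for each $m\ge0$, given $\mathbf X^m$, $(\mathbf X^{m+1},\mu^{m+1})\in\mathbb V^h\times\mathbb W^h$ satisfies $$\sum_{j=1}^3\left[\left(\frac{\mathbf X_j^{m+1}-\mathbf X_j^m}{\Delta t_m}\cdot\mathbf n_j^{m+\frac12},\varphi_j^h\right)^h_{\Gamma_j^m}+\left(\partial_{s_j}\mu_j^{m+1},\partial_{s_j}\varphi_j^h\right)^h_{\Gamma_j^m}\right]=0\qquad\forall\,\varphi^h=(\varphi^h_1,\varphi^h_2,\varphi^h_3)\in\mathbb W^h,$$ $$\begin{aligned}&\sum_{j=1}^3\left[\left(\mu_j^{m+1}\mathbf n_j^{m+\frac12},\boldsymbol\omega_j^h\right)^h_{\Gamma_j^m}-\left(\mathbf Z_{K,j}(\mathbf n_j^m)\partial_{s_j}\mathbf X_j^{m+1},\partial_{s_j}\boldsymbol\omega_j^h\right)^h_{\Gamma_j^m}\right]-\left[\frac1{\eta_1}\frac{x_A^{m+1}-x_A^m}{\Delta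 t_m}+\sigma_1\right]\omega^h_{1,1}(0)\\&\quad-\left[\frac1{\eta_2}\frac{x_B^{m+1}-x_B^m}{\Delta t_m}-\sigma_2\right]\omega^h_{2,1}(0)-\left[\frac1{\eta_3}\frac{x_C^{m+1}-x_C^m}{\Delta t_m}+\sigma_2-\sigma_1\right]\omega^h_{3,1}(0)=0\qquad\forall\,\boldsymbol\omega^h=(\boldsymbol\omega^h_1,\boldsymbol\omega^h_2,\boldsymbol\omega^h_3)\in\mathbb V^h.\end{aligned}$$ Then the total discrete free energy $$E^m=\sum_{j=1}^3\sum_{k=1}^{N_j}|\mathbf h_{j,k}^m|\,\gamma_j(\mathbf n_{j,k}^m)-\sigma_1(x_C^m-x_A^m)-\sigma_2(x_B^m-x_C^m)$$ is stable: $E^{m+1}\le E^m\le\cdots\le E^0$ for all $m\ge0$.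
   Context: Notation. $\mathbb S^1$ is the unit circle in $\mathbb R^2$, $(a,b)^\perp=(b,-a)$, $\mathbb I_j=[0,1]$ for $j=1,2,3$. Time levels $0=t_0<t_1<\dots$ have steps $\Delta t_m=t_{m+1}-t_m>0$. Each $\mathbb I_j$ is divided into $N_j$ subintervals $\mathbb I_{j,k}=[\rho_{j,k-1},\rho_{j,k}]$ with $\rho_{j,k}=k/N_j$. Surface energy. $\gamma_j\in C^2(\mathbb S^1)$, $\gamma_j>0$; $\widehat\gamma_j(\mathbf p)=|\mathbf p|\gamma_j(\mathbf p/|\mathbf p|)$ for $\mathbf p\ne\mathbf0$; $\boldsymbol\xi_j(\mathbf n)=\nabla\widehat\gamma_j(\mathbf p)|_{\mathbf p=\mathbf n}$. With a stabilizing function $K_j:\mathbb S^1\to[0,\infty)$ and $\mathbf I_2$ the $2\times2$ identity, $\mathbf Z_{K,j}(\mathbf n)=\gamma_j(\mathbf n)\mathbf I_2-\mathbf n\boldsymbol\xi_j(\mathbf n)^\top-\boldsymbol\xi_j(\mathbf n)\mathbf n^\top+K_j(\mathbf n)\mathbf n\mathbf n^\top$. Spaces. $\mathbb K^h(\mathbb I_j)$ is the space of continuous functions on $\mathbb I_j$ that are affine on each $\mathbb I_{j,k}$. $\mathbb V^h$ is the set of $(\mathbf v_1,\mathbf v_2,\mathbf v_3)\in\prod_{j=1}^3\mathbb K^h(\mathbb I_j)^2$, $\mathbf v_j=(v_{j,1},v_{j,2})$, with $v_{j,2}(0)=0$ for $j=1,2,3$ and $\mathbf v_1(1)=\mathbf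 v_2(1)=\mathbf v_3(1)$. $\mathbb W^h$ is the set of $(\chi_1,\chi_2,\chi_3)\in\prod_{j=1}^3\mathbb K^h(\mathbb I_j)$ with $\sum_{j=1}^3\chi_j(1)=0$. Components: $\boldsymbol\omega^h_j=(\omega^h_{j,1},\omega^h_{j,2})$. Discrete curves. $\mathbf X^m=(\mathbf X_1^m,\mathbf X_2^m,\mathbf X_3^m)$, $\mathbf X^m_j=(x^m_j,y^m_j)$, $\Gamma_j^m=\mathbf X_j^m(\mathbb I_j)$ is a polygonal curve, $\mu^m=(\mu^m_1,\mu^m_2,\mu^m_3)$. Segments: $\mathbf h^m_{j,k}=\mathbf X^m_j(\rho_{j,k})-\mathbf X^m_j(\rho_{j,k-1})$, all assumed nonzero. On $\mathbb I_{j,k}$ the unit normal is $\mathbf n_j^m=\mathbf n^m_{j,k}=-(\mathbf h^m_{j,k})^\perp/|\mathbf h^m_{j,k}|$. In the scheme at step $m$, $\partial_{s_j}f=\partial_{\rho_j}f/|\partial_{\rho_j}\mathbf X^m_j|$ (arc length of $\Gamma_j^m$), and $$\mathbf n_j^{m+\frac12}=-\frac{\big[\partial_{\rho_j}\mathbf X_j^m+\partial_{\rho_j}\mathbf X_j^{m+1}\big]^\perp}{2|\partial_{\rho_j}\mathbf X_j^m|}.$$ Contact points: $x_A^m=x_1^m(0)$, $x_B^m=x_2^m(0)$, $x_C^m=x_3^m(0)$. The mass-lumped inner product for (scalar or vector) functions possibly discontinuous at the nodes is $$(\mathbf u,\mathbf v)^h_{\Gamma_j^m}=\frac12\sum_{k=1}^{N_j}|\mathbf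 h^m_{j,k}|\big[(\mathbf u\cdot\mathbf v)(\rho_{j,k}^-)+(\mathbf u\cdot\mathbf v)(\rho_{j,k-1}^+)\big],$$ with $\pm$ denoting one-sided limits. *)

theory Defs
  imports "HOL-Analysis.Analysis"
begin

text \<open>The three curves are indexed by the type \<^typ>\<open>3\<close>, whose elements are \<open>1\<close>, \<open>2\<close> and
  \<open>3\<close> (with \<open>3 = 0\<close>). Functions on the reference interval \<open>[0,1]\<close> are total functions on
  \<^typ>\<open>real\<close>, and functions on the unit circle are total functions on \<^typ>\<open>real^2\<close>; values off
  these sets never matter.\<close>

definition perp :: "real^2 \<Rightarrow> real^2" where
  "perp v = vector [v $ 2, - (v $ 1)]"

definition outer :: "real^2 \<Rightarrow> real^2 \<Rightarrow> real^2^2" where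
  "outer u v = (\<chi> i j. u $ i * v $ j)"


subsection \<open>Surface energy\<close>

text \<open>\<open>C\<^sup>2\<close> on the circle as a smooth one-dimensional manifold: twice continuously differentiable
  as a function of the angle.\<close>

definition C2_circle :: "(real^2 \<Rightarrow> real) \<Rightarrow> bool" where
  "C2_circle \<gamma> \<longleftrightarrow> (\<exists>g' g''.
     (\<forall>\<theta>. ((\<lambda>t. \<gamma> (vector [cos t, sin t])) has_real_derivative g' \<theta>) (at \<theta>)) \<and>
     (\<forall>\<theta>. (g' has_real_derivative g'' \<theta>) (at \<theta>)) \<and>
     continuous_on UNIV g'')"

definition gamma_hat :: "(real^2 \<Rightarrow> real) \<Rightarrow> real^2 \<Rightarrow> real" where
  "gamma_hat \<gamma> p = norm p * \<gamma> (p /\<^sub>R norm p)"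

definition xi :: "(real^2 \<Rightarrow> real) \<Rightarrow> real^2 \<Rightarrow> real^2" where
  "xi \<gamma> n = (THE D. GDERIV (gamma_hat \<gamma>) n :> D)"

definition Z_mat :: "(real^2 \<Rightarrow> real) \<Rightarrow> (real^2 \<Rightarrow> real) \<Rightarrow> real^2 \<Rightarrow> real^2^2" where
  "Z_mat \<gamma> K n =
     \<gamma> n *\<^sub>R mat 1 - outer n (xi \<gamma> n) - outer (xi \<gamma> n) n + K n *\<^sub>R outer n n"


subsection \<open>Finite element spaces\<close>

definition rho :: "nat \<Rightarrow> nat \<Rightarrow> real" where
  "rho N k = real k / real N"

definition Kh :: "nat \<Rightarrow> (real \<Rightarrow> real) set" where
  "Kh N = {f. continuous_on {0..1} f \<and>
     (\<forall>k\<in>{1..N}. \<exists>a b. \<forall>r\<in>{rho N (k - 1)..rho N k}. f r = a + b * r)}"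

definition Vh :: "(3 \<Rightarrow> nat) \<Rightarrow> (3 \<Rightarrow> real \<Rightarrow> real^2) set" where
  "Vh N = {v. (\<forall>j i. (\<lambda>r. v j r $ i) \<in> Kh (N j)) \<and>
     (\<forall>j. v j 0 $ 2 = 0) \<and> v 1 1 = v 2 1 \<and> v 2 1 = v 3 1}"

definition Wh :: "(3 \<Rightarrow> nat) \<Rightarrow> (3 \<Rightarrow> real \<Rightarrow> real) set" where
  "Wh N = {c. (\<forall>j. c j \<in> Kh (N j)) \<and> (\<Sum>j\<in>UNIV. c j 1) = 0}"


subsection \<open>Discrete curves\<close>

text \<open>In this subsection \<open>Y\<close> is a single parametrized polygonal curve with \<open>N\<close> segments.\<close>

definition seg :: "nat \<Rightarrow> (real \<Rightarrow> real^2) \<Rightarrow> nat \<Rightarrow> real^2" where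
  "seg N Y k = Y (rho N k) - Y (rho N (k - 1))"

definition seg_normal :: "nat \<Rightarrow> (real \<Rightarrow> real^2) \<Rightarrow> nat \<Rightarrow> real^2" where
  "seg_normal N Y k = - (perp (seg N Y k) /\<^sub>R norm (seg N Y k))"

text \<open>The piecewise constant normal as a function of the parameter: for
  \<open>rho N (k - 1) < r \<le> rho N k\<close> one has \<open>\<lceil>N r\<rceil> = k\<close>. The choice made at the nodes is irrelevant,
  since below only one-sided limits at nodes are taken.\<close>

definition normal :: "nat \<Rightarrow> (real \<Rightarrow> real^2) \<Rightarrow> real \<Rightarrow> real^2" where
  "normal N Y r = seg_normal N Y (nat \<lceil>real N * r\<rceil>)"

text \<open>Derivative in the reference parameter. It is unspecified at kinks, which again only affects
  values at nodes.\<close>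

abbreviation d_rho :: "(real \<Rightarrow> 'a::real_normed_vector) \<Rightarrow> real \<Rightarrow> 'a" where
  "d_rho f r \<equiv> vector_derivative f (at r)"

definition d_s :: "(real \<Rightarrow> real^2) \<Rightarrow> (real \<Rightarrow> 'a::real_normed_vector) \<Rightarrow> real \<Rightarrow> 'a" where
  "d_s Y f r = d_rho f r /\<^sub>R norm (d_rho Y r)"

definition normal_half :: "(real \<Rightarrow> real^2) \<Rightarrow> (real \<Rightarrow> real^2) \<Rightarrow> real \<Rightarrow> real^2" where
  "normal_half Y Y' r = - (perp (d_rho Y r + d_rho Y' r) /\<^sub>R (2 * norm (d_rho Y r)))"

definition lumped ::
  "nat \<Rightarrow> (real \<Rightarrow> real^2) \<Rightarrow> (real \<Rightarrow> 'a::real_inner) \<Rightarrow> (real \<Rightarrow> 'a) \<Rightarrow> real" where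
  "lumped N Y u v = (1/2) * (\<Sum>k=1..N. norm (seg N Y k) *
     (Lim (at_left (rho N k)) (\<lambda>r. u r \<bullet> v r) +
      Lim (at_right (rho N (k - 1))) (\<lambda>r. u r \<bullet> v r)))"


subsection \<open>The scheme and the discrete energy\<close>

text \<open>One step of size \<open>\<tau>\<close> from \<open>X\<close> to \<open>(X', \<mu>')\<close>.\<close>

definition scheme_step ::
  "(3 \<Rightarrow> nat) \<Rightarrow> (3 \<Rightarrow> real^2 \<Rightarrow> real) \<Rightarrow> (3 \<Rightarrow> real^2 \<Rightarrow> real) \<Rightarrow> (3 \<Rightarrow> real) \<Rightarrow> real \<Rightarrow> real \<Rightarrow> real \<Rightarrow>
   (3 \<Rightarrow> real \<Rightarrow> real^2) \<Rightarrow> (3 \<Rightarrow> real \<Rightarrow> real^2) \<Rightarrow> (3 \<Rightarrow> real \<Rightarrow> real) \<Rightarrow> bool" where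
  "scheme_step N \<gamma> K \<eta> \<sigma>1 \<sigma>2 \<tau> X X' \<mu>' \<longleftrightarrow>
     (\<forall>\<phi>\<in>Wh N. (\<Sum>j\<in>UNIV.
         lumped (N j) (X j)
           (\<lambda>r. ((X' j r - X j r) /\<^sub>R \<tau>) \<bullet> normal_half (X j) (X' j) r) (\<phi> j) +
         lumped (N j) (X j) (d_s (X j) (\<mu>' j)) (d_s (X j) (\<phi> j))) = 0) \<and>
     (\<forall>\<omega>\<in>Vh N. (\<Sum>j\<in>UNIV.
         lumped (N j) (X j) (\<lambda>r. \<mu>' j r *\<^sub>R normal_half (X j) (X' j) r) (\<omega> j) -
         lumped (N j) (X j)
           (\<lambda>r. Z_mat (\<gamma> j) (K j) (normal (N j) (X j) r) *v d_s (X j) (X' j) r)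
           (d_s (X j) (\<omega> j)))
       - (1 / \<eta> 1 * ((X' 1 0 $ 1 - X 1 0 $ 1) / \<tau>) + \<sigma>1) * \<omega> 1 0 $ 1
       - (1 / \<eta> 2 * ((X' 2 0 $ 1 - X 2 0 $ 1) / \<tau>) - \<sigma>2) * \<omega> 2 0 $ 1
       - (1 / \<eta> 3 * ((X' 3 0 $ 1 - X 3 0 $ 1) / \<tau>) + \<sigma>2 - \<sigma>1) * \<omega> 3 0 $ 1 = 0)"

definition energy ::
  "(3 \<Rightarrow> nat) \<Rightarrow> (3 \<Rightarrow> real^2 \<Rightarrow> real) \<Rightarrow> real \<Rightarrow> real \<Rightarrow> (3 \<Rightarrow> real \<Rightarrow> real^2) \<Rightarrow> real" where
  "energy N \<gamma> \<sigma>1 \<sigma>2 X =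
     (\<Sum>j\<in>UNIV. \<Sum>k=1..N j. norm (seg (N j) (X j) k) * \<gamma> j (seg_normal (N j) (X j) k))
     - \<sigma>1 * (X 3 0 $ 1 - X 1 0 $ 1) - \<sigma>2 * (X 2 0 $ 1 - X 3 0 $ 1)"

end

theory Submission
  imports Defs
begin

text \<open>Testing the step from \<open>X\<close> to \<open>(X', \<mu>')\<close> with \<open>\<tau> \<mu>'\<close> and \<open>X' - X\<close> makes the two terms that couple
  \<open>\<mu>'\<close> and the averaged normal equal, and leaves only dissipative terms besides
  \<open>Z \<partial>\<^sub>s X' \<cdot> \<partial>\<^sub>s (X' - X)\<close> and the substrate energy. Stability thus reduces
  to an inequality on a single segment \<open>h\<close> replaced by \<open>h'\<close>. Let \<open>\<theta>\<close> be the angle of the normal of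
  \<open>h\<close>, \<open>\<theta> + \<phi>\<close> that of \<open>h'\<close>, \<open>G \<phi> = \<gamma> (\<theta> + \<phi>)\<close>, \<open>B\<^sub>1 = G 0 cos \<phi> + G' 0 sin \<phi>\<close> and \<open>r = |h'| / |h|\<close>. The
  inequality is then a quadratic one, \<open>A r\<^sup>2 - (B\<^sub>1 + G \<phi>) r + G 0 \<ge> 0\<close>, with discriminant
  \<open>(G \<phi> - B\<^sub>1) (G \<phi> + 3 B\<^sub>1) - 4 (K G 0 - (G 0)\<^sup>2 - (G' 0)\<^sup>2) sin\<^sup>2 \<phi>\<close>. The first product is at most a constant
  times \<open>sin\<^sup>2 \<phi>\<close>, so a large \<open>K\<close> makes the discriminant nonpositive.\<close>

subsection \<open>The gradient of the one-homogeneous extension\<close>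

text \<open>The parametrization used in \<open>C2_circle\<close>. As \<open>perp\<close> turns
  clockwise, the counterclockwise unit tangent at \<open>circ \<theta>\<close> is
  \<open>- perp (circ \<theta>)\<close>.\<close>

definition circ :: "real \<Rightarrow> real^2" where
  "circ \<theta> = vector [cos \<theta>, sin \<theta>]"

lemma circ_nth [simp]: "circ \<theta> $ 1 = cos \<theta>" "circ \<theta> $ 2 = sin \<theta>"
  by (simp_all add: circ_def)

lemma perp_nth [simp]: "perp v $ 1 = v $ 2" "perp v $ 2 = - (v $ 1)"
  by (simp_all add: perp_def)

lemma inner_real2: "(u::real^2) \<bullet> v = u $ 1 * v $ 1 + u $ 2 * v $ 2"
  by (simp add: inner_vec_def UNIV_2)

lemma real2_eq_iff: "(u::real^2) = v \<longleftrightarrow> u $ 1 = v $ 1 \<and> u $ 2 = v $ 2"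
  by (simp add: vec_eq_iff forall_2)

lemma norm_perp [simp]: "norm (perp v) = norm v"
  by (simp add: norm_eq_sqrt_inner inner_real2 algebra_simps)

lemma perp_perp [simp]: "perp (perp v) = - v"
  by (simp add: real2_eq_iff)

lemma perp_scaleR [simp]: "perp (c *\<^sub>R v) = c *\<^sub>R perp v"
  by (simp add: real2_eq_iff)

lemma perp_minus [simp]: "perp (- v) = - perp v"
  by (simp add: real2_eq_iff)

lemma norm_circ [simp]: "norm (circ \<theta>) = 1"
  by (simp add: norm_eq_sqrt_inner inner_real2 flip: power2_eq_square)

lemma circ_add: "circ (\<theta> + \<phi>) = cos \<phi> *\<^sub>R circ \<theta> - sin \<phi> *\<^sub>R perp (circ \<theta>)"
  by (simp add: real2_eq_iff cos_add sin_add)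

lemma circ_add_pi: "circ (\<theta> + pi) = - circ \<theta>" "circ (\<theta> - pi) = - circ \<theta>"
  by (simp_all add: real2_eq_iff cos_diff sin_diff)

text \<open>The coordinates of \<open>v\<close> in the orthonormal frame
  \<open>circ \<theta>\<close>, \<open>- perp (circ \<theta>)\<close> are the cosine and sine of the
  angle from \<open>circ \<theta>\<close> to \<open>v\<close>.\<close>

lemma unit_vector_eq_circ:
  assumes "norm v = 1"
  obtains \<phi> where "- pi \<le> \<phi>" "\<phi> \<le> pi" "v = circ (\<theta> + \<phi>)"
proof -
  let ?c = "v \<bullet> circ \<theta>" and ?s = "v \<bullet> - perp (circ \<theta>)"
  have v: "v $ 1 ^ 2 + v $ 2 ^ 2 = 1"
    using assms by (simp add: norm_eq_1 inner_real2 power2_eq_square)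
  \<comment> \<open>Taking the angle of the negated coordinates in \<open>[0, 2 * pi)\<close> and
    subtracting \<open>pi\<close> afterwards centres the range at 0.\<close>
  have "(- ?c)\<^sup>2 + (- ?s)\<^sup>2 = (v $ 1 ^ 2 + v $ 2 ^ 2) * ((cos \<theta>)\<^sup>2 + (sin \<theta>)\<^sup>2)"
    unfolding inner_real2 by (simp del: sin_cos_squared_add2) algebra
  then have "(- ?c)\<^sup>2 + (- ?s)\<^sup>2 = 1"
    using v by simp
  then obtain t where t: "0 \<le> t" "t < 2 * pi" "- ?c = cos t" "- ?s = sin t"
    using sincos_total_2pi by metis
  have cs: "cos (t - pi) = ?c" "sin (t - pi) = ?s"
    using t by (simp_all add: cos_diff sin_diff)
  have sq: "sin \<theta> * sin \<theta> = 1 - cos \<theta> * cos \<theta>"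
    using sin_cos_squared_add[of \<theta>] by (simp add: power2_eq_square)
  have "v = circ (\<theta> + (t - pi))"
    unfolding circ_add cs real2_eq_iff
    by (simp add: inner_real2, intro conjI) (use sq in algebra)+
  then show thesis
    using t that[of "t - pi"] by simp
qed

text \<open>On the half-plane \<open>p \<bullet> circ \<theta> > 0\<close> the polar angle of
  \<open>p\<close> is \<open>\<theta>\<close> plus the arctangent of tangential over normal
  coordinate. There \<open>gamma_hat\<close> is the norm times \<open>\<gamma>\<close> of that
  angle, and product and chain rule give a radial part \<open>\<gamma>\<close> and a tangential part
  \<open>g1\<close>.\<close>

lemma gamma_hat_has_gderiv:
  assumes "((\<lambda>t. \<gamma> (circ t)) has_real_derivative g1) (at \<theta>)"
  shows "GDERIV (gamma_hat \<gamma>) (circ \<theta>) :> \<gamma> (circ \<theta>) *\<^sub>R circ \<theta> - g1 *\<^sub>R perp (circ \<theta>)"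
proof -
  let ?n = "circ \<theta>" and ?t = "- perp (circ \<theta>)"
  let ?f = "\<lambda>p. norm p * \<gamma> (circ (\<theta> + arctan ((p \<bullet> ?t) / (p \<bullet> ?n))))"
  have nn: "?n \<bullet> ?n = 1" "?n \<bullet> ?t = 0"
    by (simp_all add: dot_square_norm inner_real2)
  have "circ \<theta> \<noteq> 0"
    using norm_circ[of \<theta>] by fastforce
  then have norm: "(norm has_derivative (\<lambda>h. h \<bullet> ?n)) (at ?n)"
    using GDERIV_norm[of ?n] by (simp add: gderiv_def sgn_div_norm)
  have D: "((\<lambda>t. \<gamma> (circ t)) has_derivative (*) g1) (at (\<theta> + arctan ((?n \<bullet> ?t) / (?n \<bullet> ?n))))"
    using assms nn by (simp add: has_field_derivative_def)
  \<comment> \<open>At \<open>?n\<close> the quotient has numerator 0 and denominator 1, so its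
    derivative is that of the numerator, and \<open>arctan\<close> has slope 1 at 0.\<close>
  have "((\<lambda>p. \<theta> + arctan ((p \<bullet> ?t) / (p \<bullet> ?n))) has_derivative (\<lambda>h. h \<bullet> ?t)) (at ?n)"
    using nn by (auto intro!: derivative_eq_intros simp: fun_eq_iff)
  from has_derivative_compose[OF this D]
  have "((\<lambda>p. \<gamma> (circ (\<theta> + arctan ((p \<bullet> ?t) / (p \<bullet> ?n))))) has_derivative (\<lambda>h. g1 * (h \<bullet> ?t))) (at ?n)"
    by simp
  then have "(?f has_derivative (\<lambda>h. (h \<bullet> ?n) * \<gamma> (circ \<theta>) + g1 * (h \<bullet> ?t))) (at ?n)"
    using nn norm by (auto intro!: derivative_eq_intros simp: fun_eq_iff)
  then have "(?f has_derivative (\<lambda>h. h \<bullet> (\<gamma> ?n *\<^sub>R ?n - g1 *\<^sub>R perp ?n))) (at ?n)"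
    by (simp add: inner_diff_right mult.commute)
  moreover have "open {p. 0 < p \<bullet> ?n}"
    by (intro open_Collect_less continuous_intros)
  moreover have "?n \<in> {p. 0 < p \<bullet> ?n}"
    using nn by simp
  moreover have "?f p = gamma_hat \<gamma> p" if "p \<in> {p. 0 < p \<bullet> ?n}" for p
  proof -
    let ?x = "p \<bullet> ?n" and ?y = "p \<bullet> ?t"
    have x: "?x > 0" using that by simp
    have "?x\<^sup>2 + ?y\<^sup>2 = (p \<bullet> p) * ((cos \<theta>)\<^sup>2 + (sin \<theta>)\<^sup>2)"
      unfolding inner_real2 by (simp del: sin_cos_squared_add2) algebra
    then have p: "norm p = sqrt (?x\<^sup>2 + ?y\<^sup>2)"
      by (simp add: norm_eq_sqrt_inner)
    have "sqrt (1 + (?y / ?x)\<^sup>2) = norm p / ?x"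
      unfolding p using x by (auto simp: field_simps real_sqrt_divide intro!: real_sqrt_unique)
    then have cs: "cos (arctan (?y / ?x)) = ?x / norm p" "sin (arctan (?y / ?x)) = ?y / norm p"
      using x by (simp_all add: cos_arctan sin_arctan)
    have "?x *\<^sub>R ?n + ?y *\<^sub>R ?t = ((cos \<theta>)\<^sup>2 + (sin \<theta>)\<^sup>2) *\<^sub>R p"
      unfolding real2_eq_iff
      by (simp add: inner_real2 del: sin_cos_squared_add2) algebra
    moreover have "circ (\<theta> + arctan (?y / ?x)) = (?x *\<^sub>R ?n + ?y *\<^sub>R ?t) /\<^sub>R norm p"
      unfolding circ_add cs by (simp add: real2_eq_iff divide_inverse algebra_simps)
    ultimately have "circ (\<theta> + arctan (?y / ?x)) = p /\<^sub>R norm p"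
      by simp
    then show ?thesis
      by (simp add: gamma_hat_def)
  qed
  ultimately show ?thesis
    unfolding gderiv_def by (rule has_derivative_transform_within_open)
qed

text \<open>Uniqueness of the derivative resolves the definite description in \<open>xi\<close>; the
  result is the Cahn-Hoffman vector in the frame of normal and tangent.\<close>

lemma xi_circ:
  assumes "((\<lambda>t. \<gamma> (circ t)) has_real_derivative g1) (at \<theta>)"
  shows "xi \<gamma> (circ \<theta>) = \<gamma> (circ \<theta>) *\<^sub>R circ \<theta> - g1 *\<^sub>R perp (circ \<theta>)"
  unfolding xi_def
proof (rule the_equality)
  show D: "GDERIV (gamma_hat \<gamma>) (circ \<theta>) :> \<gamma> (circ \<theta>) *\<^sub>R circ \<theta> - g1 *\<^sub>R perp (circ \<theta>)"
    using assms by (rule gamma_hat_has_gderiv)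
  show "E = \<gamma> (circ \<theta>) *\<^sub>R circ \<theta> - g1 *\<^sub>R perp (circ \<theta>)"
    if "GDERIV (gamma_hat \<gamma>) (circ \<theta>) :> E" for E
    using has_derivative_unique[OF that[unfolded gderiv_def] D[unfolded gderiv_def]]
    by (metis vector_eq_ldot)
qed

lemma Z_mat_inner:
  "(Z_mat \<gamma> K n *v w) \<bullet> z =
     \<gamma> n * (w \<bullet> z) - (xi \<gamma> n \<bullet> w) * (n \<bullet> z) - (n \<bullet> w) * (xi \<gamma> n \<bullet> z) + K n * (n \<bullet> w) * (n \<bullet> z)"
  by (simp add: Z_mat_def outer_def inner_real2 matrix_vector_mult_def UNIV_2 mat_def algebra_simps)

subsection \<open>The estimate for one segment\<close>

text \<open>Since \<open>R' x / x\<close> tends to \<open>R''\<close>, the derivative is at most a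
  constant times \<open>\<bar>x\<bar>\<close> on the ball of radius \<open>\<bar>x\<bar>\<close>;
  the mean value inequality supplies the second factor.\<close>

lemma le_square_near_double_zero:
  fixes R R' :: "real \<Rightarrow> real"
  assumes R: "\<And>x. (R has_real_derivative R' x) (at x)"
    and R': "(R' has_real_derivative R'') (at 0)"
    and "R 0 = 0" "R' 0 = 0"
  obtains C d where "0 < d" "\<And>x. \<bar>x\<bar> < d \<Longrightarrow> \<bar>R x\<bar> \<le> C * x\<^sup>2"
proof -
  have "((\<lambda>x. R' x / x) \<longlongrightarrow> R'') (at 0)"
    using R' assms by (simp add: has_field_derivative_iff)
  then have "\<forall>\<^sub>F x in at 0. \<bar>R' x / x\<bar> < \<bar>R''\<bar> + 1"
    by (intro order_tendstoD(2)[OF tendsto_rabs]) auto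
  then obtain d where d: "0 < d" "\<And>x. x \<noteq> 0 \<Longrightarrow> \<bar>x\<bar> < d \<Longrightarrow> \<bar>R' x / x\<bar> < \<bar>R''\<bar> + 1"
    by (auto simp: eventually_at dist_real_def)
  have R'_le: "\<bar>R' y\<bar> \<le> (\<bar>R''\<bar> + 1) * \<bar>x\<bar>" if "\<bar>y\<bar> \<le> \<bar>x\<bar>" "\<bar>x\<bar> < d" for x y
  proof (cases "y = 0")
    case False
    then have "\<bar>R' y\<bar> \<le> (\<bar>R''\<bar> + 1) * \<bar>y\<bar>"
      using d(2)[of y] that by (simp add: field_simps)
    also have "\<dots> \<le> (\<bar>R''\<bar> + 1) * \<bar>x\<bar>"
      using that by (intro mult_left_mono) auto
    finally show ?thesis .
  qed (use assms in auto)
  have "\<bar>R x\<bar> \<le> (\<bar>R''\<bar> + 1) * x\<^sup>2" if "\<bar>x\<bar> < d" for x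
  proof -
    have "norm (R x - R 0) \<le> ((\<bar>R''\<bar> + 1) * \<bar>x\<bar>) * norm (x - 0)"
    proof (rule field_differentiable_bound[of "cball 0 \<bar>x\<bar>" R R'])
      show "(R has_real_derivative R' z) (at z within cball 0 \<bar>x\<bar>)" for z
        using R by (rule has_field_derivative_at_within)
    qed (use R'_le that in auto)
    then show ?thesis
      using assms by (simp add: power2_eq_square algebra_simps abs_mult_self_eq)
  qed
  with d(1) show thesis
    by (rule that)
qed

lemma isCont_eventually_less:
  fixes f :: "real \<Rightarrow> real"
  assumes "isCont f x" "f x < c"
  shows "\<forall>\<^sub>F y in nhds x. f y < c"
  using assms order_tendstoD(2)[of f "f x" "nhds x" c]
  by (simp add: isCont_def tendsto_at_iff_tendsto_nhds)

text \<open>Only the zeros of \<open>sin\<close> are critical: at \<open>0\<close> the first factor vanishes to second order, and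
  at \<open>\<plusminus>\<pi>\<close> the product is negative because of the hypothesis \<open>G (\<plusminus>\<pi>) < 3 G 0\<close>.\<close>

lemma product_le_sin_squared:
  fixes G G' :: "real \<Rightarrow> real"
  assumes G: "\<And>x. (G has_real_derivative G' x) (at x)"
    and G': "(G' has_real_derivative G'') (at 0)"
    and pos: "\<And>x. 0 < G x"
    and pi: "G pi < 3 * G 0" "G (- pi) < 3 * G 0"
  obtains C where "\<And>x. - pi \<le> x \<Longrightarrow> x \<le> pi \<Longrightarrow>
    (G x - (G 0 * cos x + G' 0 * sin x)) * (G x + 3 * (G 0 * cos x + G' 0 * sin x)) \<le> C * (sin x)\<^sup>2"
proof -
  define R where "R x = G x - (G 0 * cos x + G' 0 * sin x)" for x
  define S where "S x = G x + 3 * (G 0 * cos x + G' 0 * sin x)" for x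
  have cont_G: "isCont G x" for x
    using G DERIV_isCont by blast
  have cont: "isCont (\<lambda>x. R x * S x) x" "isCont S x" for x
    unfolding R_def S_def by (intro continuous_intros cont_G)+
  \<comment> \<open>A compactness argument: adjacent intervals merge by taking the larger constant,
    and each point has a neighbourhood with some constant, so bisection yields one constant for
    \<open>[- pi, pi]\<close>.\<close>
  define P where "P a b \<longleftrightarrow> (\<exists>C\<ge>0. \<forall>x\<in>{a..b}. R x * S x \<le> C * (sin x)\<^sup>2)" for a b
  have P: "P a b" if "0 < d" "a \<le> x" "x \<le> b" "b - a < d"
    "\<And>y. \<bar>y - x\<bar> < d \<Longrightarrow> R y * S y \<le> C * (sin y)\<^sup>2" for a b x d C
    unfolding P_def
  proof (intro exI[of _ "max 0 C"] conjI ballI)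
    fix y assume "y \<in> {a..b}"
    then have "R y * S y \<le> C * (sin y)\<^sup>2"
      using that by auto
    also have "\<dots> \<le> max 0 C * (sin y)\<^sup>2"
      by (intro mult_right_mono) auto
    finally show "R y * S y \<le> max 0 C * (sin y)\<^sup>2" .
  qed auto
  have loc: "\<exists>d>0. \<forall>a b. a \<le> x \<and> x \<le> b \<and> b - a < d \<longrightarrow> P a b"
    if bound: "\<forall>\<^sub>F y in nhds x. R y * S y \<le> C * (sin y)\<^sup>2" for x C
  proof -
    obtain d where "0 < d" "\<And>y. \<bar>y - x\<bar> < d \<Longrightarrow> R y * S y \<le> C * (sin y)\<^sup>2"
      using bound by (auto simp: eventually_nhds_metric dist_real_def)
    then show ?thesis
      using P by blast
  qed
  have "- pi \<le> pi"
    by simp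
  then have "P (- pi) pi"
  proof (induction rule: Bolzano)
    case (trans a b c)
    then obtain C D where
      CD: "C \<ge> 0" "\<forall>x\<in>{a..b}. R x * S x \<le> C * (sin x)\<^sup>2" "\<forall>x\<in>{b..c}. R x * S x \<le> D * (sin x)\<^sup>2"
      by (auto simp: P_def)
    have "R x * S x \<le> max C D * (sin x)\<^sup>2" if "x \<in> {a..c}" for x
    proof -
      have "R x * S x \<le> C * (sin x)\<^sup>2 \<or> R x * S x \<le> D * (sin x)\<^sup>2"
        using that CD by (metis atLeastAtMost_iff linear)
      moreover have "C * (sin x)\<^sup>2 \<le> max C D * (sin x)\<^sup>2" "D * (sin x)\<^sup>2 \<le> max C D * (sin x)\<^sup>2"
        by (intro mult_right_mono; simp)+
      ultimately show ?thesis by linarith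
    qed
    then show ?case
      unfolding P_def using CD(1) by (intro exI[of _ "max C D"]) auto
  next
    case (local x)
    consider "sin x \<noteq> 0" | "x = 0" | "x = pi \<or> x = - pi"
      using local sin_eq_0_pi[of x] by fastforce
    then show ?case
    proof cases
      case 1
      \<comment> \<open>Away from the zeros of \<open>sin\<close> the quotient is continuous, hence
        locally below its value at \<open>x\<close> plus 1.\<close>
      have "isCont (\<lambda>y. R y * S y / (sin y)\<^sup>2) x"
        using 1 by (intro continuous_intros cont) auto
      then have "\<forall>\<^sub>F y in nhds x. R y * S y / (sin y)\<^sup>2 < R x * S x / (sin x)\<^sup>2 + 1"
        by (rule isCont_eventually_less) simp
      moreover have "\<forall>\<^sub>F y in nhds x. sin y \<noteq> 0"
        using 1 by (intro tendsto_imp_eventually_ne)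
          (auto intro!: tendsto_intros filterlim_ident)
      ultimately have "\<forall>\<^sub>F y in nhds x. R y * S y \<le> (R x * S x / (sin x)\<^sup>2 + 1) * (sin y)\<^sup>2"
        by eventually_elim (simp add: divide_less_eq)
      then show ?thesis
        by (rule loc)
    next
      case 2
      \<comment> \<open>The subtracted combination of \<open>cos\<close> and \<open>sin\<close>
        agrees with \<open>G\<close> at 0 to first order, so \<open>R\<close> has a double zero
        there and is of order \<open>y^2\<close>, while \<open>S\<close> is merely bounded.\<close>
      have "(R has_real_derivative G' y - (G' 0 * cos y - G 0 * sin y)) (at y)" for y
        unfolding R_def by (auto intro!: derivative_eq_intros G)
      moreover have "((\<lambda>y. G' y - (G' 0 * cos y - G 0 * sin y)) has_real_derivative G'' + G 0) (at 0)"
        by (auto intro!: derivative_eq_intros G')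
      ultimately obtain C d where
        C: "0 < d" "\<And>y. \<bar>y\<bar> < d \<Longrightarrow> \<bar>R y\<bar> \<le> C * y\<^sup>2"
        by (rule le_square_near_double_zero) (auto simp: R_def)
      have "\<forall>\<^sub>F y in nhds 0. \<bar>R y\<bar> \<le> C * y\<^sup>2"
        using C by (auto simp: eventually_nhds_metric dist_real_def)
      moreover have "\<forall>\<^sub>F y in nhds 0. \<bar>S y\<bar> < \<bar>S 0\<bar> + 1"
        by (intro isCont_eventually_less isCont_rabs cont) simp
      \<comment> \<open>Near 0 the ratio \<open>sin y / y\<close> exceeds 1/2; squaring gives the
        factor 4.\<close>
      moreover have "\<forall>\<^sub>F y in nhds (0::real). y\<^sup>2 \<le> 4 * (sin y)\<^sup>2"
      proof -
        have "((\<lambda>y::real. sin y / y) \<longlongrightarrow> 1) (at 0)"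
          using DERIV_sin[of "0::real"] by (simp add: has_field_derivative_iff)
        then have "\<forall>\<^sub>F y::real in at 0. 1/2 < sin y / y"
          by (intro order_tendstoD) auto
        then have "\<forall>\<^sub>F y::real in at 0. y\<^sup>2 \<le> 4 * (sin y)\<^sup>2"
        proof eventually_elim
          case (elim y)
          then have "(1/2)\<^sup>2 \<le> (sin y / y)\<^sup>2"
            by (intro power_mono) auto
          moreover have "y \<noteq> 0"
            using elim by auto
          ultimately show ?case
            by (simp add: power_divide le_divide_eq)
        qed
        then show ?thesis
          by (simp add: eventually_nhds_conv_at)
      qed
      ultimately have "\<forall>\<^sub>F y in nhds 0. R y * S y \<le> (\<bar>C\<bar> * 4 * (\<bar>S 0\<bar> + 1)) * (sin y)\<^sup>2"
      proof eventually_elim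
        case (elim y)
        have "R y * S y \<le> \<bar>R y\<bar> * \<bar>S y\<bar>"
          by (metis abs_ge_self abs_mult)
        also have "\<dots> \<le> (\<bar>C\<bar> * (4 * (sin y)\<^sup>2)) * (\<bar>S 0\<bar> + 1)"
        proof (rule mult_mono)
          have "C * y\<^sup>2 \<le> \<bar>C\<bar> * y\<^sup>2"
            by (intro mult_right_mono) auto
          also have "\<dots> \<le> \<bar>C\<bar> * (4 * (sin y)\<^sup>2)"
            using elim by (intro mult_left_mono) auto
          finally show "\<bar>R y\<bar> \<le> \<bar>C\<bar> * (4 * (sin y)\<^sup>2)"
            using elim by simp
        qed (use elim in auto)
        finally show ?case
          by (simp only: mult_ac)
      qed
      then show ?thesis
        using 2 loc by blast
    next
      case 3
      \<comment> \<open>With \<open>cos x = - 1\<close> and \<open>sin x = 0\<close>, positivity of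
        \<open>G\<close> makes \<open>R x\<close> positive and the factor 3 in the hypothesis makes
        \<open>S x\<close> negative, so the constant 0 works nearby.\<close>
      then have "R x = G x + G 0" "S x = G x - 3 * G 0"
        by (auto simp: R_def S_def)
      then have "R x * S x < 0"
        using pi 3 pos[of 0] pos[of x] by (auto intro!: mult_pos_neg)
      then have "\<forall>\<^sub>F y in nhds x. R y * S y < 0"
        by (intro isCont_eventually_less cont)
      then have "\<forall>\<^sub>F y in nhds x. R y * S y \<le> 0 * (sin y)\<^sup>2"
        by eventually_elim simp
      then show ?thesis
        by (rule loc)
    qed
  qed
  then obtain C where C: "\<And>x. x \<in> {- pi..pi} \<Longrightarrow> R x * S x \<le> C * (sin x)\<^sup>2"
    unfolding P_def by blast
  show thesis
    by (rule that[of C]) (use C in \<open>simp add: R_def S_def\<close>)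
qed

text \<open>\<open>Z_mat\<close> depends on the function \<open>K\<close> only through the number \<open>k = K n\<close>.\<close>

definition stabilizes :: "(real^2 \<Rightarrow> real) \<Rightarrow> real^2 \<Rightarrow> real \<Rightarrow> bool" where
  "stabilizes \<gamma> n k \<longleftrightarrow> (\<forall>h h'. h \<noteq> 0 \<longrightarrow> h' \<noteq> 0 \<longrightarrow> n = - (perp h /\<^sub>R norm h) \<longrightarrow>
     norm h' * \<gamma> (- (perp h' /\<^sub>R norm h')) - norm h * \<gamma> n
     \<le> norm h * ((Z_mat \<gamma> (\<lambda>_. k) n *v (h' /\<^sub>R norm h)) \<bullet> ((h' - h) /\<^sub>R norm h)))"

text \<open>The square is completed after multiplying by \<open>4 * c\<close>, because it is the
  constant term \<open>c\<close>, later \<open>G 0\<close>, whose sign is known.\<close>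

lemma quadratic_nonneg:
  fixes a b c r :: real
  assumes "0 < c" "b\<^sup>2 \<le> 4 * a * c"
  shows "0 \<le> a * r\<^sup>2 - b * r + c"
proof -
  have "0 \<le> (2 * c - b * r)\<^sup>2 + (4 * a * c - b\<^sup>2) * r\<^sup>2"
    using assms by simp
  also have "\<dots> = 4 * c * (a * r\<^sup>2 - b * r + c)"
    by (simp add: power2_eq_square algebra_simps)
  finally show ?thesis
    using assms by (simp add: zero_le_mult_iff)
qed

text \<open>One threshold serves all pairs of segments: the angle between them is handled by a
  uniform constant \<open>C\<close>, and the ratio of their lengths is the variable of a
  quadratic.\<close>

lemma ex_stabilizes:
  assumes C2: "C2_circle \<gamma>"
    and pos: "\<And>n. norm n = 1 \<Longrightarrow> 0 < \<gamma> n"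
    and lt3: "\<And>n. norm n = 1 \<Longrightarrow> \<gamma> (- n) < 3 * \<gamma> n"
    and n: "norm n = 1"
  obtains k0 where "0 \<le> k0" "\<And>k. k0 \<le> k \<Longrightarrow> stabilizes \<gamma> n k"
proof -
  obtain \<theta> where \<theta>: "n = circ \<theta>"
    using unit_vector_eq_circ[OF n, of 0] by force
  obtain g' g'' where g': "\<And>t. ((\<lambda>t. \<gamma> (circ t)) has_real_derivative g' t) (at t)"
    and g'': "\<And>t. (g' has_real_derivative g'' t) (at t)"
    using C2 unfolding C2_circle_def circ_def by blast
  define G where "G x = \<gamma> (circ (\<theta> + x))" for x
  define G' where "G' x = g' (\<theta> + x)" for x
  have G: "(G has_real_derivative G' x) (at x)" for x
    unfolding G_def G'_def using DERIV_shift[of "\<lambda>t. \<gamma> (circ t)" "g' (\<theta> + x)" x \<theta>] g'[of "\<theta> + x"]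
    by (simp add: add.commute)
  have G': "(G' has_real_derivative g'' \<theta>) (at 0)"
    unfolding G'_def using DERIV_shift[of g' "g'' \<theta>" 0 \<theta>] g''[of \<theta>]
    by (simp add: add.commute)
  obtain C where C: "\<And>x. - pi \<le> x \<Longrightarrow> x \<le> pi \<Longrightarrow>
    (G x - (G 0 * cos x + G' 0 * sin x)) * (G x + 3 * (G 0 * cos x + G' 0 * sin x)) \<le> C * (sin x)\<^sup>2"
  proof (rule product_le_sin_squared[OF G G'])
    show "0 < G x" for x
      by (simp add: G_def pos)
    show "G pi < 3 * G 0" "G (- pi) < 3 * G 0"
      using lt3[of "circ \<theta>"] by (simp_all add: G_def circ_add_pi)
  qed blast
  have G0: "0 < G 0"
    by (simp add: G_def pos)
  have xi: "xi \<gamma> n = G 0 *\<^sub>R n - G' 0 *\<^sub>R perp n"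
    using xi_circ[OF g', of \<theta>] by (simp add: \<theta> G_def G'_def)
  \<comment> \<open>The threshold solves \<open>C = 4 * (k * G 0 - (G 0)^2 - (G' 0)^2)\<close> for
    \<open>k\<close>.\<close>
  have "stabilizes \<gamma> n k" if "(C / 4 + (G 0)\<^sup>2 + (G' 0)\<^sup>2) / G 0 \<le> k" for k
    unfolding stabilizes_def
  proof (intro allI impI)
    fix h h' :: "real^2"
    assume h: "h \<noteq> 0" "h' \<noteq> 0" "n = - (perp h /\<^sub>R norm h)"
    define r where "r = norm h' / norm h"
    define z where "z = (h' - h) /\<^sub>R norm h"
    define w where "w = h' /\<^sub>R norm h"
    have "norm (- (perp h' /\<^sub>R norm h')) = 1"
      using h by simp
    then obtain \<phi> where \<phi>: "- pi \<le> \<phi>" "\<phi> \<le> pi" "- (perp h' /\<^sub>R norm h') = circ (\<theta> + \<phi>)"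
      by (rule unit_vector_eq_circ)
    let ?c = "cos \<phi>" and ?s = "sin \<phi>"
    \<comment> \<open>\<open>perp n\<close> is the unit tangent of \<open>h\<close>; below, the unit
      tangent of \<open>h'\<close> is written in the frame \<open>perp n\<close>,
      \<open>n\<close>.\<close>
    have u: "h /\<^sub>R norm h = perp n"
      using h by simp
    have "h' /\<^sub>R norm h' = perp (- (perp h' /\<^sub>R norm h'))"
      by simp
    also have "\<dots> = ?c *\<^sub>R perp n + ?s *\<^sub>R n"
      unfolding \<phi>(3) circ_add \<theta> by (simp add: real2_eq_iff)
    finally have "r *\<^sub>R (?c *\<^sub>R perp n + ?s *\<^sub>R n) = r *\<^sub>R (h' /\<^sub>R norm h')"
      by simp
    also have "\<dots> = w"
      using h(2) by (simp add: r_def w_def divide_inverse)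
    finally have w: "w = r *\<^sub>R (?c *\<^sub>R perp n + ?s *\<^sub>R n)" ..
    have z: "z = w - perp n"
      unfolding z_def w_def by (simp add: scaleR_diff_right u)
    have dots: "n \<bullet> n = 1" "perp n \<bullet> perp n = 1" "n \<bullet> perp n = 0" "perp n \<bullet> n = 0"
      using n by (simp_all add: dot_square_norm inner_real2)
    have sc: "?c * ?c = 1 - ?s * ?s"
      using sin_cos_squared_add[of \<phi>] by (simp add: power2_eq_square)
    \<comment> \<open>\<open>A\<close> is the quadratic form of \<open>Z_mat\<close> on the unit
      tangent of \<open>h'\<close>, the only place where \<open>k\<close> enters;
      \<open>B - G \<phi>\<close> is its pairing with the unit tangent of \<open>h\<close>.\<close>
    define A where "A = G 0 * ?c\<^sup>2 + 2 * G' 0 * ?s * ?c + (k - G 0) * ?s\<^sup>2"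
    define B where "B = G 0 * ?c + G' 0 * ?s + G \<phi>"
    have "\<gamma> n = G 0"
      by (simp add: \<theta> G_def)
    then have Zwz: "(Z_mat \<gamma> (\<lambda>_. k) n *v w) \<bullet> z = A * r\<^sup>2 - (B - G \<phi>) * r"
      unfolding Z_mat_inner xi z w
      by (simp add: inner_add_left inner_add_right inner_diff_left inner_diff_right dots
          A_def B_def power2_eq_square algebra_simps sc)
    have "C / 4 + (G 0)\<^sup>2 + (G' 0)\<^sup>2 \<le> k * G 0"
      using that G0 by (simp add: divide_le_eq)
    then have "C * ?s\<^sup>2 \<le> (4 * (k * G 0 - (G 0)\<^sup>2 - (G' 0)\<^sup>2)) * ?s\<^sup>2"
      by (intro mult_right_mono) auto
    \<comment> \<open>With \<open>b = B - G \<phi>\<close>, one has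
      \<open>B^2 = (G \<phi> - b) * (G \<phi> + 3 * b) + 4 * b^2\<close>. In
      \<open>4 * b^2 - 4 * A * G 0\<close> the \<open>cos^2\<close> and mixed terms cancel, which
      leaves a multiple of \<open>sin^2\<close>.\<close>
    moreover have "B\<^sup>2 - 4 * A * G 0 =
      (G \<phi> - (G 0 * ?c + G' 0 * ?s)) * (G \<phi> + 3 * (G 0 * ?c + G' 0 * ?s))
      - (4 * (k * G 0 - (G 0)\<^sup>2 - (G' 0)\<^sup>2)) * ?s\<^sup>2"
      by (simp add: A_def B_def power2_eq_square algebra_simps)
    ultimately have "B\<^sup>2 \<le> 4 * A * G 0"
      using C[OF \<phi>(1,2)] by linarith
    then have "0 \<le> A * r\<^sup>2 - B * r + G 0"
      using G0 by (intro quadratic_nonneg)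
    then have "r * G \<phi> - G 0 \<le> (Z_mat \<gamma> (\<lambda>_. k) n *v w) \<bullet> z"
      unfolding Zwz by (simp add: algebra_simps)
    then have "norm h * (r * G \<phi> - G 0) \<le> norm h * ((Z_mat \<gamma> (\<lambda>_. k) n *v w) \<bullet> z)"
      by (intro mult_left_mono) auto
    moreover have "norm h * (r * G \<phi> - G 0) = norm h' * G \<phi> - norm h * G 0"
      using h by (simp add: r_def field_simps)
    ultimately show "norm h' * \<gamma> (- (perp h' /\<^sub>R norm h')) - norm h * \<gamma> n
      \<le> norm h * ((Z_mat \<gamma> (\<lambda>_. k) n *v (h' /\<^sub>R norm h)) \<bullet> ((h' - h) /\<^sub>R norm h))"
      unfolding \<phi>(3) by (simp add: \<open>\<gamma> n = G 0\<close> G_def flip: w_def z_def)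
  qed
  then show thesis
    using that[of "max 0 ((C / 4 + (G 0)\<^sup>2 + (G' 0)\<^sup>2) / G 0)"] by simp
qed

subsection \<open>Elementwise affine functions\<close>

text \<open>Interpolation form, with \<open>real N\<close> the inverse element length: the slope is
  read off from nodal values, for scalars and vectors alike.\<close>

definition elem_affine :: "nat \<Rightarrow> (real \<Rightarrow> 'a::real_normed_vector) \<Rightarrow> bool" where
  "elem_affine N f \<longleftrightarrow> (\<forall>k\<in>{1..N}. \<forall>r\<in>{rho N (k - 1)..rho N k}.
     f r = f (rho N (k - 1)) + ((r - rho N (k - 1)) * real N) *\<^sub>R (f (rho N k) - f (rho N (k - 1))))"

lemma elem_affineD:
  assumes "elem_affine N f" "k \<in> {1..N}" "r \<in> {rho N (k - 1)..rho N k}"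
  shows "f r = f (rho N (k - 1)) + ((r - rho N (k - 1)) * real N) *\<^sub>R (f (rho N k) - f (rho N (k - 1)))"
  using assms unfolding elem_affine_def by blast

lemma rho_diff:
  assumes "k \<in> {1..N}"
  shows "rho N k - rho N (k - 1) = 1 / real N"
  using assms by (simp add: rho_def of_nat_diff field_simps)

lemma rho_less:
  assumes "k \<in> {1..N}"
  shows "rho N (k - 1) < rho N k"
proof -
  have "0 < rho N k - rho N (k - 1)"
    unfolding rho_diff[OF assms] using assms by simp
  then show ?thesis by simp
qed

lemma elem_affine_Kh:
  assumes "f \<in> Kh N"
  shows "elem_affine N f"
  unfolding elem_affine_def
proof (intro ballI)
  fix k r
  assume k: "k \<in> {1..N}" and r: "r \<in> {rho N (k - 1)..rho N k}"
  obtain a b where ab: "\<And>r. r \<in> {rho N (k - 1)..rho N k} \<Longrightarrow> f r = a + b * r"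
    using assms k unfolding Kh_def by blast
  have "f (rho N k) - f (rho N (k - 1)) = b * (rho N k - rho N (k - 1))"
    using rho_less[OF k] by (simp add: ab algebra_simps)
  then have "real N * (f (rho N k) - f (rho N (k - 1))) = b"
    unfolding rho_diff[OF k] using k by simp
  then have eq: "((r - rho N (k - 1)) * real N) *\<^sub>R (f (rho N k) - f (rho N (k - 1))) = (r - rho N (k - 1)) * b"
    by (simp add: mult.assoc)
  have "f r = a + b * r" "f (rho N (k - 1)) = a + b * rho N (k - 1)"
    using ab[OF r] ab[of "rho N (k - 1)"] rho_less[OF k] by simp_all
  then show "f r = f (rho N (k - 1)) + ((r - rho N (k - 1)) * real N) *\<^sub>R (f (rho N k) - f (rho N (k - 1)))"
    unfolding eq by (simp add: algebra_simps)
qed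

lemma elem_affine_vec:
  fixes f :: "real \<Rightarrow> real^'n"
  assumes "\<And>i. elem_affine N (\<lambda>r. f r $ i)"
  shows "elem_affine N f"
  unfolding elem_affine_def vec_eq_iff
proof (intro ballI allI)
  fix k r i
  assume "k \<in> {1..N}" "r \<in> {rho N (k - 1)..rho N k}"
  then have "f r $ i = f (rho N (k - 1)) $ i
      + ((r - rho N (k - 1)) * real N) *\<^sub>R (f (rho N k) $ i - f (rho N (k - 1)) $ i)"
    by (rule elem_affineD[OF assms])
  then show "f r $ i = (f (rho N (k - 1))
      + ((r - rho N (k - 1)) * real N) *\<^sub>R (f (rho N k) - f (rho N (k - 1)))) $ i"
    by (simp only: vector_add_component vector_scaleR_component vector_minus_component)
qed

lemma elem_affine_Vh: "v \<in> Vh N \<Longrightarrow> elem_affine (N j) (v j)"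
  by (intro elem_affine_vec elem_affine_Kh) (simp add: Vh_def)

lemma elem_affine_Wh: "c \<in> Wh N \<Longrightarrow> elem_affine (N j) (c j)"
  by (intro elem_affine_Kh) (simp add: Wh_def)

lemma d_rho_elem_affine:
  assumes f: "elem_affine N f" and k: "k \<in> {1..N}" and r: "r \<in> {rho N (k - 1)<..<rho N k}"
  shows "d_rho f r = real N *\<^sub>R (f (rho N k) - f (rho N (k - 1)))"
proof (rule vector_derivative_at)
  let ?d = "f (rho N k) - f (rho N (k - 1))"
  have "((\<lambda>r. f (rho N (k - 1)) + ((r - rho N (k - 1)) * real N) *\<^sub>R ?d) has_vector_derivative real N *\<^sub>R ?d) (at r)"
    by (auto intro!: derivative_eq_intros)
  then show "(f has_vector_derivative real N *\<^sub>R ?d) (at r)"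
    by (rule has_vector_derivative_transform_within_open[OF _ open_greaterThanLessThan r])
      (rule elem_affineD[OF f k, symmetric], simp)
qed

text \<open>Both parameter derivatives carry the factor \<open>real N\<close>, which
  cancels.\<close>

lemma d_s_elem_affine:
  assumes "elem_affine N Y" "elem_affine N f" and k: "k \<in> {1..N}"
    and r: "r \<in> {rho N (k - 1)<..<rho N k}"
  shows "d_s Y f r = (f (rho N k) - f (rho N (k - 1))) /\<^sub>R norm (seg N Y k)"
  using k by (simp add: d_s_def d_rho_elem_affine[OF _ k r] assms seg_def)

lemma normal_elem:
  assumes k: "k \<in> {1..N}" and r: "r \<in> {rho N (k - 1)<..<rho N k}"
  shows "normal N Y r = seg_normal N Y k"
proof -
  have "\<lceil>real N * r\<rceil> = int k"
    using k r by (intro ceiling_unique) (auto simp: rho_def field_simps of_nat_diff)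
  then show ?thesis
    by (simp add: normal_def)
qed

text \<open>Both one-sided limits see only the interior of element \<open>k\<close>, where the
  product is constant; the two equal contributions absorb the factor 1/2.\<close>

lemma lumped_elementwise:
  assumes "\<And>k r. k \<in> {1..N} \<Longrightarrow> r \<in> {rho N (k - 1)<..<rho N k} \<Longrightarrow> u r \<bullet> v r = c k"
  shows "lumped N Y u v = (\<Sum>k=1..N. norm (seg N Y k) * c k)"
proof -
  have "Lim (at_left (rho N k)) (\<lambda>r. u r \<bullet> v r) = c k"
    "Lim (at_right (rho N (k - 1))) (\<lambda>r. u r \<bullet> v r) = c k" if k: "k \<in> {1..N}" for k
  proof -
    have "((\<lambda>r. u r \<bullet> v r) \<longlongrightarrow> c k) (at_left (rho N k))"
      by (rule tendsto_eventually, use rho_less[OF k] in \<open>rule eventually_at_leftI[rotated]\<close>) (use assms k in blast)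
    moreover have "((\<lambda>r. u r \<bullet> v r) \<longlongrightarrow> c k) (at_right (rho N (k - 1)))"
      by (rule tendsto_eventually, use rho_less[OF k] in \<open>rule eventually_at_rightI[rotated]\<close>) (use assms k in blast)
    ultimately show "Lim (at_left (rho N k)) (\<lambda>r. u r \<bullet> v r) = c k"
      "Lim (at_right (rho N (k - 1))) (\<lambda>r. u r \<bullet> v r) = c k"
      by (auto intro: tendsto_Lim)
  qed
  then show ?thesis
    by (simp add: lumped_def sum_distrib_left)
qed

text \<open>Only the pointwise product matters, so a factor may move between the slots, even from a
  scalar to a vector pairing.\<close>

lemma lumped_cong:
  assumes "\<And>r. u r \<bullet> v r = u' r \<bullet> v' r"
  shows "lumped N Y u v = lumped N Y u' v'"
  using assms by (simp add: lumped_def)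

section \<open>Closure properties that make the test functions admissible\<close>

lemma Kh_diff: "f \<in> Kh N \<Longrightarrow> g \<in> Kh N \<Longrightarrow> (\<lambda>r. f r - g r) \<in> Kh N"
  unfolding Kh_def
proof (safe, goal_cases)
  case (2 k)
  then obtain a b c d where "\<forall>r\<in>{rho N (k - 1)..rho N k}. f r = a + b * r"
    "\<forall>r\<in>{rho N (k - 1)..rho N k}. g r = c + d * r"
    by meson
  then show ?case
    by (intro exI[of _ "a - c"] exI[of _ "b - d"]) (simp add: algebra_simps)
qed (intro continuous_intros)

lemma Kh_mult_left: "f \<in> Kh N \<Longrightarrow> (\<lambda>r. c * f r) \<in> Kh N"
  unfolding Kh_def
proof (safe, goal_cases)
  case (2 k)
  then obtain a b where "\<forall>r\<in>{rho N (k - 1)..rho N k}. f r = a + b * r"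
    by meson
  then show ?case
    by (intro exI[of _ "c * a"] exI[of _ "c * b"]) (simp add: algebra_simps)
qed (intro continuous_intros)

lemma Vh_diff: "v \<in> Vh N \<Longrightarrow> w \<in> Vh N \<Longrightarrow> (\<lambda>j r. v j r - w j r) \<in> Vh N"
  by (simp add: Vh_def Kh_diff)

lemma Wh_mult_left: "w \<in> Wh N \<Longrightarrow> (\<lambda>j r. c * w j r) \<in> Wh N"
  by (simp add: Wh_def Kh_mult_left flip: sum_distrib_left)

lemma Z_mat_cong: "K n = k \<Longrightarrow> Z_mat \<gamma> K n = Z_mat \<gamma> (\<lambda>_. k) n"
  by (simp add: Z_mat_def)

subsection \<open>Energy decay\<close>

text \<open>Testing with a nonnegative multiple of \<open>f\<close> itself leaves a multiple of the
  squared arc-length slope on each element.\<close>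

lemma lumped_dissipation_nonneg:
  fixes f :: "real \<Rightarrow> real"
  assumes "elem_affine N Y" "elem_affine N f" "elem_affine N (\<lambda>r. \<tau> * f r)" "0 \<le> \<tau>"
  shows "0 \<le> lumped N Y (d_s Y f) (d_s Y (\<lambda>r. \<tau> * f r))"
proof -
  let ?c = "\<lambda>k. \<tau> * ((f (rho N k) - f (rho N (k - 1))) /\<^sub>R norm (seg N Y k))\<^sup>2"
  have "lumped N Y (d_s Y f) (d_s Y (\<lambda>r. \<tau> * f r)) = (\<Sum>k=1..N. norm (seg N Y k) * ?c k)"
    by (rule lumped_elementwise)
      (simp add: d_s_elem_affine[OF assms(1,2)] d_s_elem_affine[OF assms(1,3)]
        power2_eq_square algebra_simps)
  also have "\<dots> \<ge> 0"
    using assms(4) by (intro sum_nonneg mult_nonneg_nonneg) auto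
  finally show ?thesis .
qed

text \<open>Normals and arc-length derivatives are constant on elements, so the lumped product is a
  sum over segments, and \<open>stabilizes\<close> applies to each old segment and its
  successor.\<close>

lemma surface_energy_increment_le:
  assumes Y: "elem_affine N Y" "elem_affine N Y'" "elem_affine N (\<lambda>r. Y' r - Y r)"
    and nz: "\<And>k. k \<in> {1..N} \<Longrightarrow> seg N Y k \<noteq> 0" "\<And>k. k \<in> {1..N} \<Longrightarrow> seg N Y' k \<noteq> 0"
    and stab: "\<And>n. norm n = 1 \<Longrightarrow> stabilizes \<gamma> n (K n)"
  shows "(\<Sum>k=1..N. norm (seg N Y' k) * \<gamma> (seg_normal N Y' k))
      - (\<Sum>k=1..N. norm (seg N Y k) * \<gamma> (seg_normal N Y k))
    \<le> lumped N Y (\<lambda>r. Z_mat \<gamma> K (normal N Y r) *v d_s Y Y' r) (d_s Y (\<lambda>r. Y' r - Y r))"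
proof -
  define c where "c k = (Z_mat \<gamma> K (seg_normal N Y k) *v (seg N Y' k /\<^sub>R norm (seg N Y k)))
    \<bullet> ((seg N Y' k - seg N Y k) /\<^sub>R norm (seg N Y k))" for k
  have "lumped N Y (\<lambda>r. Z_mat \<gamma> K (normal N Y r) *v d_s Y Y' r) (d_s Y (\<lambda>r. Y' r - Y r))
    = (\<Sum>k=1..N. norm (seg N Y k) * c k)"
    by (rule lumped_elementwise)
      (simp add: normal_elem d_s_elem_affine[OF Y(1,2)] d_s_elem_affine[OF Y(1,3)] c_def
        seg_def[of N Y'] seg_def[of N Y] algebra_simps)
  moreover have "norm (seg N Y' k) * \<gamma> (seg_normal N Y' k) - norm (seg N Y k) * \<gamma> (seg_normal N Y k)
      \<le> norm (seg N Y k) * c k" if k: "k \<in> {1..N}" for k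
  proof -
    have "norm (seg_normal N Y k) = 1"
      using nz(1)[OF k] by (simp add: seg_normal_def)
    from stab[OF this] show ?thesis
      using nz[OF k] unfolding stabilizes_def c_def Z_mat_cong[OF refl, of \<gamma> K "seg_normal N Y k"]
      by (simp only: seg_normal_def) blast
  qed
  ultimately show ?thesis
    unfolding sum_subtractf[symmetric] by (auto intro: sum_mono)
qed

lemma energy_step_le:
  assumes step: "scheme_step N \<gamma> K \<eta> \<sigma>1 \<sigma>2 \<tau> X X' \<mu>'"
    and \<tau>: "0 < \<tau>" and \<eta>: "\<And>j. 0 < \<eta> j"
    and X: "X \<in> Vh N" "X' \<in> Vh N" and \<mu>': "\<mu>' \<in> Wh N"
    and nz: "\<And>j k. k \<in> {1..N j} \<Longrightarrow> seg (N j) (X j) k \<noteq> 0"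
      "\<And>j k. k \<in> {1..N j} \<Longrightarrow> seg (N j) (X' j) k \<noteq> 0"
    and stab: "\<And>j n. norm n = 1 \<Longrightarrow> stabilizes (\<gamma> j) n (K j n)"
  shows "energy N \<gamma> \<sigma>1 \<sigma>2 X' \<le> energy N \<gamma> \<sigma>1 \<sigma>2 X"
proof -
  define W where "W X j = (\<Sum>k=1..N j. norm (seg (N j) (X j) k) * \<gamma> j (seg_normal (N j) (X j) k))" for X j
  define d where "d j = X' j 0 $ 1 - X j 0 $ 1" for j
  \<comment> \<open>The contact-line friction: \<open>a j * d j\<close> is
    \<open>(d j)^2 / (\<eta> j * \<tau>)\<close>, hence dissipative.\<close>
  define a where "a j = 1 / \<eta> j * (d j / \<tau>)" for j
  let ?m = "\<lambda>j. lumped (N j) (X j) (\<lambda>r. \<mu>' j r *\<^sub>R normal_half (X j) (X' j) r) (\<lambda>r. X' j r - X j r)"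
  let ?s = "\<lambda>j. lumped (N j) (X j) (d_s (X j) (\<mu>' j)) (d_s (X j) (\<lambda>r. \<tau> * \<mu>' j r))"
  let ?z = "\<lambda>j. lumped (N j) (X j) (\<lambda>r. Z_mat (\<gamma> j) (K j) (normal (N j) (X j) r) *v d_s (X j) (X' j) r)
    (d_s (X j) (\<lambda>r. X' j r - X j r))"
  have \<phi>: "(\<lambda>j r. \<tau> * \<mu>' j r) \<in> Wh N" and \<omega>: "(\<lambda>j r. X' j r - X j r) \<in> Vh N"
    using \<mu>' X by (auto intro: Wh_mult_left Vh_diff)
  have "(\<Sum>j\<in>UNIV. lumped (N j) (X j)
      (\<lambda>r. ((X' j r - X j r) /\<^sub>R \<tau>) \<bullet> normal_half (X j) (X' j) r) (\<lambda>r. \<tau> * \<mu>' j r) + ?s j) = 0"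
    by (rule bspec[OF conjunct1[OF step[unfolded scheme_step_def]] \<phi>])
  \<comment> \<open>The factor \<open>\<tau>\<close> of the test function cancels the division by
    \<open>\<tau>\<close>, giving the coupling term of the second equation.\<close>
  moreover have "lumped (N j) (X j)
      (\<lambda>r. ((X' j r - X j r) /\<^sub>R \<tau>) \<bullet> normal_half (X j) (X' j) r) (\<lambda>r. \<tau> * \<mu>' j r) = ?m j" for j
    using \<tau> by (intro lumped_cong) (simp add: inner_commute)
  ultimately have "(\<Sum>j\<in>UNIV. ?m j) + (\<Sum>j\<in>UNIV. ?s j) = 0"
    by (simp add: sum.distrib)
  moreover have "0 \<le> (\<Sum>j\<in>UNIV. ?s j)"
    using \<tau> by (intro sum_nonneg lumped_dissipation_nonneg elem_affine_Vh[OF X(1)]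
        elem_affine_Wh[OF \<mu>'] elem_affine_Wh[OF \<phi>]) auto
  moreover have "(\<Sum>j\<in>UNIV. ?m j - ?z j)
      - (a 1 + \<sigma>1) * d 1 - (a 2 - \<sigma>2) * d 2 - (a 3 + \<sigma>2 - \<sigma>1) * d 3 = 0"
    using bspec[OF conjunct2[OF step[unfolded scheme_step_def]] \<omega>]
    by (simp only: a_def d_def vector_minus_component)
  moreover have "0 \<le> a j * d j" for j
    using \<tau> \<eta>[of j] by (simp add: a_def)
  note this[of 1] this[of 2] this[of 3]
  moreover have "(\<Sum>j\<in>UNIV. W X' j - W X j) \<le> (\<Sum>j\<in>UNIV. ?z j)"
    unfolding W_def
    by (intro sum_mono surface_energy_increment_le elem_affine_Vh[OF X(1)] elem_affine_Vh[OF X(2)]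
        elem_affine_Vh[OF \<omega>] nz stab)
  \<comment> \<open>Eliminating the coupling term expresses the sum of \<open>?z\<close> as minus
    the dissipation plus the right-hand side below, which is exactly the decrease of the substrate
    terms of \<open>energy\<close>.\<close>
  ultimately have "(\<Sum>j\<in>UNIV. W X' j - W X j) \<le> \<sigma>1 * (d 3 - d 1) + \<sigma>2 * (d 2 - d 3)"
    unfolding sum_subtractf ring_distribs by linarith
  then show ?thesis
    unfolding energy_def W_def[symmetric] d_def sum_subtractf ring_distribs by linarith
qed

text \<open>\<open>K0\<close> takes a single density and is quantified before all other data, which
  expresses that the threshold depends on that density alone.\<close>

theorem proposition4p2:
  shows "\<exists>K0 :: (real^2 \<Rightarrow> real) \<Rightarrow> real^2 \<Rightarrow> real.
    (\<forall>g. \<forall>n\<in>sphere 0 1. 0 \<le> K0 g n) \<and>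
    (\<forall>(\<gamma> :: 3 \<Rightarrow> real^2 \<Rightarrow> real) (K :: 3 \<Rightarrow> real^2 \<Rightarrow> real) (\<eta> :: 3 \<Rightarrow> real) (\<sigma>1 :: real) (\<sigma>2 :: real)
      (N :: 3 \<Rightarrow> nat) (t :: nat \<Rightarrow> real)
      (X :: nat \<Rightarrow> 3 \<Rightarrow> real \<Rightarrow> real^2) (\<mu> :: nat \<Rightarrow> 3 \<Rightarrow> real \<Rightarrow> real).
      (\<forall>j. C2_circle (\<gamma> j)) \<longrightarrow>
      (\<forall>j. \<forall>n\<in>sphere 0 1. 0 < \<gamma> j n) \<longrightarrow>
      (\<forall>j. \<forall>n\<in>sphere 0 1. \<gamma> j (- n) < 3 * \<gamma> j n) \<longrightarrow>
      (\<forall>j. \<forall>n\<in>sphere 0 1. 0 \<le> K j n) \<longrightarrow>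
      (\<forall>j. \<forall>n\<in>sphere 0 1. K0 (\<gamma> j) n \<le> K j n) \<longrightarrow>
      (\<forall>j. 0 < \<eta> j) \<longrightarrow>
      (\<forall>j. 1 \<le> N j) \<longrightarrow>
      t 0 = 0 \<longrightarrow>
      strict_mono t \<longrightarrow>
      (\<forall>m. X m \<in> Vh N) \<longrightarrow>
      (\<forall>m. \<mu> (Suc m) \<in> Wh N) \<longrightarrow>
      (\<forall>m j. \<forall>k\<in>{1..N j}. seg (N j) (X m j) k \<noteq> 0) \<longrightarrow>
      (\<forall>m. scheme_step N \<gamma> K \<eta> \<sigma>1 \<sigma>2 (t (Suc m) - t m) (X m) (X (Suc m)) (\<mu> (Suc m))) \<longrightarrow>
      (\<forall>m. energy N \<gamma> \<sigma>1 \<sigma>2 (X (Suc m)) \<le> energy N \<gamma> \<sigma>1 \<sigma>2 (X m) \<and>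
           energy N \<gamma> \<sigma>1 \<sigma>2 (X m) \<le> energy N \<gamma> \<sigma>1 \<sigma>2 (X 0)))"
proof -
  define good where "good g n k0 \<longleftrightarrow> 0 \<le> k0 \<and> (\<forall>k\<ge>k0. stabilizes g n k)"
    for g :: "real^2 \<Rightarrow> real" and n and k0 :: real
  \<comment> \<open>The threshold is chosen separately for each \<open>g\<close> and
    \<open>n\<close>; the default 0 keeps \<open>K0\<close> nonnegative where no threshold
    exists.\<close>
  define K0 where "K0 g n = (if \<exists>k0. good g n k0 then SOME k0. good g n k0 else 0)"
    for g :: "real^2 \<Rightarrow> real" and n
  have K0: "good g n (K0 g n)" if "\<exists>k0. good g n k0" for g n
    using that someI_ex[OF that] by (simp add: K0_def)
  show ?thesis
  proof (intro exI[of _ K0] conjI allI impI ballI)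
    show "0 \<le> K0 g n" for g n
      using K0[of g n] by (cases "\<exists>k0. good g n k0") (auto simp: good_def K0_def)
  next
    fix \<gamma> :: "3 \<Rightarrow> real^2 \<Rightarrow> real" and K :: "3 \<Rightarrow> real^2 \<Rightarrow> real" and \<eta> :: "3 \<Rightarrow> real"
      and \<sigma>1 \<sigma>2 :: real and N :: "3 \<Rightarrow> nat" and t :: "nat \<Rightarrow> real"
      and X :: "nat \<Rightarrow> 3 \<Rightarrow> real \<Rightarrow> real^2" and \<mu> :: "nat \<Rightarrow> 3 \<Rightarrow> real \<Rightarrow> real" and m
    assume \<gamma>: "\<forall>j. C2_circle (\<gamma> j)" "\<forall>j. \<forall>n\<in>sphere 0 1. 0 < \<gamma> j n"
        "\<forall>j. \<forall>n\<in>sphere 0 1. \<gamma> j (- n) < 3 * \<gamma> j n"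
      and K: "\<forall>j. \<forall>n\<in>sphere 0 1. K0 (\<gamma> j) n \<le> K j n"
      and \<eta>: "\<forall>j. 0 < \<eta> j" and t: "strict_mono t"
      and X: "\<forall>m. X m \<in> Vh N" and \<mu>: "\<forall>m. \<mu> (Suc m) \<in> Wh N"
      and nz: "\<forall>m j. \<forall>k\<in>{1..N j}. seg (N j) (X m j) k \<noteq> 0"
      and step: "\<forall>m. scheme_step N \<gamma> K \<eta> \<sigma>1 \<sigma>2 (t (Suc m) - t m) (X m) (X (Suc m)) (\<mu> (Suc m))"
    have stab: "stabilizes (\<gamma> j) n (K j n)" if n: "norm n = 1" for j n
    proof -
      obtain k0 where "0 \<le> k0" "\<And>k. k0 \<le> k \<Longrightarrow> stabilizes (\<gamma> j) n k"
        by (rule ex_stabilizes[of "\<gamma> j" n]) (use \<gamma> n in auto)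
      then have "good (\<gamma> j) n (K0 (\<gamma> j) n)"
        using K0 unfolding good_def by blast
      then show ?thesis
        using K n by (simp add: good_def)
    qed
    have le: "energy N \<gamma> \<sigma>1 \<sigma>2 (X (Suc m)) \<le> energy N \<gamma> \<sigma>1 \<sigma>2 (X m)" for m
    proof (rule energy_step_le)
      show "0 < t (Suc m) - t m"
        using t by (simp add: strict_mono_Suc_iff)
    qed (use step \<eta> X \<mu> nz stab in auto)
    then show "energy N \<gamma> \<sigma>1 \<sigma>2 (X (Suc m)) \<le> energy N \<gamma> \<sigma>1 \<sigma>2 (X m)" .
    show "energy N \<gamma> \<sigma>1 \<sigma>2 (X m) \<le> energy N \<gamma> \<sigma>1 \<sigma>2 (X 0)"
      using lift_Suc_antimono_le[of "\<lambda>m. energy N \<gamma> \<sigma>1 \<sigma>2 (X m)" 0 m] le by simp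
  qed
qed

end
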